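(* Let $\mathcal{Y}$ be an $m\times n$ zero-nonzero pattern, let $G$ be the cobipartite graph associated with $\mathcal{Y}$, and suppose $G$ is saturated with respect to the corresponding clique partition. Then, over any field, $M(G)=Z(G)$ implies $\operatorname{mr}(\mathcal{Y})=\operatorname{tri}(\mathcal{Y})$. Moreover, when the field is infinite, the converse also holds.
   Context: A zero-nonzero pattern is a matrix with entries in $\{0,*\}$; the pattern of a matrix replaces each nonzero entry by $*$. Over a field $\mathbb F$, $\operatorname{mr}(\mathcal{Y})$ is the smallest rank of a matrix over $\mathbb F$ with pattern $\mathcal{Y}$. A square pattern is a triangle if some row permutation followed by some independent column permutation yields a lower-triangular pattern with only $*$ on the diagonal; $\operatorname{tri}(\mathcal{Y})$ is the largest size of a square submatrix of $\mathcal{Y}$ that is a triangle. For a simple graph $G$, $\mathcal S(G,\mathbb F)$ is the set of symmetric matrices over $\mathbb F$ whose off-diagonal $(i,j)$ entry is nonzero iff $\{i,j\}\in E(G)$ (diagonal arbitrary); $M(G)$ is the maximum nullity of a matrix in $\mathcal S(G,\mathbb F)$. The cobipartite graph associated with $\mathcal{Y}$ has vertex set $V_r\cup V_c$, $V_r=\{r_1,\dots,r_m\}$, $V_c=\{c_1,\dots,c_n\}$, each a clique, with $r_i\sim c_j$ iff $\mathcal{Y}_{ij}=*$; $(V_r,V_c)$ is the corresponding clique partition, and $G$ is saturated with respect to it if every vertex of each part has a neighbor in the other part. $Z(G)$ is the zero forcing number: the smallest size of an initially filled set from which repeatedly applying "a filled vertex whose only unfilled neighbor is $u$ forces $u$ to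 become filled" fills all vertices. *)

theory Defs
  imports
    "Jordan_Normal_Form.Matrix_Kernel"
    "Jordan_Normal_Form.DL_Rank"
    "Jordan_Normal_Form.DL_Submatrix"
    "Graph_Theory.Pair_Digraph"
begin

section \<open>Zero-nonzero patterns\<close>

datatype zn_entry = Zero | Star

definition pattern_of :: "'a::zero mat \<Rightarrow> zn_entry mat" where
  "pattern_of A = map_mat (\<lambda>x. if x = 0 then Zero else Star) A"

definition min_rank :: "'a::field itself \<Rightarrow> zn_entry mat \<Rightarrow> nat" where
  "min_rank F Y = (LEAST r. \<exists>A :: 'a mat. pattern_of A = Y \<and> vec_space.rank (dim_row Y) A = r)"

definition is_triangle :: "zn_entry mat \<Rightarrow> bool" where
  "is_triangle T \<longleftrightarrow> square_mat T \<and>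
     (\<exists>p q. p permutes {0..<dim_row T} \<and> q permutes {0..<dim_row T} \<and>
       (\<forall>i<dim_row T. T $$ (p i, q i) = Star) \<and>
       (\<forall>i<dim_row T. \<forall>j<dim_row T. i < j \<longrightarrow> T $$ (p i, q j) = Zero))"

text \<open>The empty pattern counts as a triangle of size \<open>0\<close>, so the maximum is over a nonempty set.\<close>

definition tri :: "zn_entry mat \<Rightarrow> nat" where
  "tri Y = Max {dim_row (submatrix Y I J) | I J.
     I \<subseteq> {0..<dim_row Y} \<and> J \<subseteq> {0..<dim_col Y} \<and> is_triangle (submatrix Y I J)}"

section \<open>Simple graphs\<close>

text \<open>A simple graph is a \<^const>\<open>pair_graph\<close>, that is, a finite, symmetric, loopless set of pairs.\<close>

text \<open>Rows and columns of a matrix in \<open>sym_mats G\<close> are indexed by the vertices of \<open>G\<close>;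
  the definition is meant for graphs with vertex set \<open>{0..<n}\<close>.\<close>

definition sym_mats :: "nat pair_pre_digraph \<Rightarrow> 'a::field mat set" where
  "sym_mats G = {A \<in> carrier_mat (card (pverts G)) (card (pverts G)).
     transpose_mat A = A \<and>
     (\<forall>i\<in>pverts G. \<forall>j\<in>pverts G. i \<noteq> j \<longrightarrow> (A $$ (i, j) \<noteq> 0 \<longleftrightarrow> (i, j) \<in> parcs G))}"

definition max_nullity :: "'a::field itself \<Rightarrow> nat pair_pre_digraph \<Rightarrow> nat" where
  "max_nullity F G = Max (kernel_dim ` (sym_mats G :: 'a mat set))"

inductive force :: "'v pair_pre_digraph \<Rightarrow> 'v set \<Rightarrow> 'v set \<Rightarrow> bool" for G where
  "v \<in> B \<Longrightarrow> {w. (v, w) \<in> parcs G \<and> w \<notin> B} = {u} \<Longrightarrow> force G B (insert u B)"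

definition zero_forcing_set :: "'v pair_pre_digraph \<Rightarrow> 'v set \<Rightarrow> bool" where
  "zero_forcing_set G B \<longleftrightarrow> B \<subseteq> pverts G \<and> (force G)\<^sup>*\<^sup>* B (pverts G)"

definition zero_forcing_number :: "'v pair_pre_digraph \<Rightarrow> nat" where
  "zero_forcing_number G = (LEAST k. \<exists>B. zero_forcing_set G B \<and> card B = k)"

section \<open>The cobipartite graph of a pattern\<close>

text \<open>For an \<open>m \<times> n\<close> pattern, row \<open>i < m\<close> is the vertex \<open>i\<close> and column \<open>j < n\<close> is the vertex \<open>m + j\<close>.\<close>

definition row_verts :: "zn_entry mat \<Rightarrow> nat set" where
  "row_verts Y = {0..<dim_row Y}"

definition col_verts :: "zn_entry mat \<Rightarrow> nat set" where
  "col_verts Y = {dim_row Y..<dim_row Y + dim_col Y}"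

definition cobipartite_graph :: "zn_entry mat \<Rightarrow> nat pair_pre_digraph" where
  "cobipartite_graph Y = \<lparr>
     pverts = row_verts Y \<union> col_verts Y,
     parcs =
       {(u, v). u \<in> row_verts Y \<and> v \<in> row_verts Y \<and> u \<noteq> v} \<union>
       {(u, v). u \<in> col_verts Y \<and> v \<in> col_verts Y \<and> u \<noteq> v} \<union>
       {(i, dim_row Y + j) | i j. i < dim_row Y \<and> j < dim_col Y \<and> Y $$ (i, j) = Star} \<union>
       {(dim_row Y + j, i) | i j. i < dim_row Y \<and> j < dim_col Y \<and> Y $$ (i, j) = Star} \<rparr>"

definition saturated :: "'v pair_pre_digraph \<Rightarrow> 'v set \<Rightarrow> 'v set \<Rightarrow> bool" where
  "saturated G V W \<longleftrightarrow>
     (\<forall>v\<in>V. \<exists>w\<in>W. (v, w) \<in> parcs G) \<and> (\<forall>w\<in>W. \<exists>v\<in>V. (w, v) \<in> parcs G)"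

section \<open>The extrema above are taken over nonempty, bounded sets\<close>

lemma pverts_cobipartite_graph:
  "pverts (cobipartite_graph Y) = {0..<dim_row Y + dim_col Y}"
  by (auto simp: cobipartite_graph_def row_verts_def col_verts_def)

lemma pair_graph_cobipartite_graph: "pair_graph (cobipartite_graph Y)"
proof
  show "finite (pverts (cobipartite_graph Y))"
    by (simp add: pverts_cobipartite_graph)
  have sub: "parcs (cobipartite_graph Y)
      \<subseteq> pverts (cobipartite_graph Y) \<times> pverts (cobipartite_graph Y)"
    by (auto simp: cobipartite_graph_def row_verts_def col_verts_def)
  then show "finite (parcs (cobipartite_graph Y))"
    by (rule finite_subset) (simp add: pverts_cobipartite_graph)
  fix e assume e: "e \<in> parcs (cobipartite_graph Y)"
  show "fst e \<in> pverts (cobipartite_graph Y)" "snd e \<in> pverts (cobipartite_graph Y)"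
    using sub e by auto
  show "fst e \<noteq> snd e"
    using e by (auto simp: cobipartite_graph_def row_verts_def col_verts_def)
next
  show "symmetric (with_proj (cobipartite_graph Y))"
    unfolding symmetric_def by (auto simp: cobipartite_graph_def sym_def)
qed

lemma pattern_exists: "\<exists>A :: 'a::field mat. pattern_of A = Y"
proof
  show "pattern_of (map_mat (\<lambda>x. if x = Zero then 0 else 1 :: 'a) Y) = Y"
    by (rule eq_matI) (simp_all add: pattern_of_def, metis (full_types) zn_entry.exhaust)
qed

lemma triangle_empty: "is_triangle (submatrix Y {} {})"
  by (simp add: is_triangle_def dim_submatrix)

lemma finite_triangle_sizes:
  "finite {dim_row (submatrix Y I J) | I J.
     I \<subseteq> {0..<dim_row Y} \<and> J \<subseteq> {0..<dim_col Y} \<and> is_triangle (submatrix Y I J)}"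
  (is "finite ?S")
proof -
  have "?S \<subseteq> (\<lambda>(I, J). dim_row (submatrix Y I J)) ` (Pow {0..<dim_row Y} \<times> Pow {0..<dim_col Y})"
    by auto
  then show ?thesis by (rule finite_subset) auto
qed

lemma finite_nullities: "finite (kernel_dim ` (sym_mats G :: 'a::field mat set))"
proof (rule finite_subset)
  show "kernel_dim ` (sym_mats G :: 'a mat set) \<subseteq> {..card (pverts G)}"
    by (auto simp: sym_mats_def kernel_dim_code)
qed simp

lemma sym_mats_cobipartite_graph_nonempty:
  "(sym_mats (cobipartite_graph Y) :: 'a::field mat set) \<noteq> {}"
proof -
  let ?G = "cobipartite_graph Y"
  let ?n = "dim_row Y + dim_col Y"
  have s: "(i, j) \<in> parcs ?G \<longleftrightarrow> (j, i) \<in> parcs ?G" for i j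
    by (auto simp: cobipartite_graph_def)
  have "mat ?n ?n (\<lambda>e. if e \<in> parcs ?G then 1 else 0 :: 'a) \<in> sym_mats ?G"
    unfolding sym_mats_def pverts_cobipartite_graph
    by (simp add: mat_eq_iff) (metis s)
  then show ?thesis by blast
qed

lemma zero_forcing_set_pverts: "zero_forcing_set G (pverts G)"
  by (simp add: zero_forcing_set_def)

end

theory Submission
  imports Defs
begin

text \<open>Both parameters are determined by the pattern. A triangle of size \<open>k\<close> lets all rows and
  the remaining columns force the \<open>k\<close> chosen columns one after another. Conversely, in a
  chronological list of forces \<open>v\<^sub>i \<rightarrow> u\<^sub>i\<close> no \<open>v\<^sub>i\<close> is adjacent to a later \<open>u\<^sub>j\<close>, which up
  to two replacements at the ends is a triangle. Hence \<open>Z(G) = m + n - tri(Y)\<close>.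

  A matrix in \<open>S(G)\<close> has a block with pattern \<open>Y\<close>, so \<open>M(G) \<le> m + n - mr(Y)\<close>, and over an infinite
  field a matrix of minimum rank with pattern \<open>Y\<close> completes to one in \<open>S(G)\<close> of the same rank, so
  that equality holds. As \<open>tri(Y) \<le> mr(Y)\<close>, both implications follow.\<close>

section \<open>Rank and factorizations\<close>

text \<open>Padding \<open>V\<close> with zero rows to a square matrix \<open>W\<close> makes row
  \<open>r\<close> of \<open>W\<close> zero, so \<open>det W = 0\<close> and \<open>W\<close> kills
  some nonzero vector, which \<open>V\<close> then kills too.\<close>

lemma wide_mat_kernel_nonzero:
  fixes V :: "'a::field mat"
  assumes V: "V \<in> carrier_mat r n" and "r < n"
  obtains x where "x \<in> carrier_vec n" "x \<noteq> 0\<^sub>v n" "V *\<^sub>v x = 0\<^sub>v r"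
proof -
  define W where "W = mat n n (\<lambda>(i, j). if i < r then V $$ (i, j) else 0)"
  have W: "W \<in> carrier_mat n n" by (simp add: W_def)
  have "transpose_mat W *\<^sub>v unit_vec n r = 0\<^sub>v n"
    using W \<open>r < n\<close> by (intro eq_vecI) (auto simp: W_def)
  then have "det (transpose_mat W) = 0"
    using W \<open>r < n\<close> det_0_iff_vec_prod_zero_field[of "transpose_mat W" n]
    by (auto intro!: exI[of _ "unit_vec n r"])
  then have "det W = 0"
    by (simp add: det_transpose[OF W])
  then obtain x where x: "x \<in> carrier_vec n" "x \<noteq> 0\<^sub>v n" "W *\<^sub>v x = 0\<^sub>v n"
    using det_0_iff_vec_prod_zero_field[OF W] by auto
  have "V *\<^sub>v x = 0\<^sub>v r"
  proof (rule eq_vecI)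
    fix i assume "i < dim_vec (0\<^sub>v r :: 'a vec)"
    then have i: "i < r" by simp
    have "row V i = row W i"
      using V i \<open>r < n\<close> by (intro eq_vecI) (auto simp: W_def)
    then have "(V *\<^sub>v x) $ i = (W *\<^sub>v x) $ i"
      using V W i \<open>r < n\<close> by simp
    then show "(V *\<^sub>v x) $ i = 0\<^sub>v r $ i"
      using x(3) i \<open>r < n\<close> by simp
  qed (use V in auto)
  with x that show ?thesis by blast
qed

text \<open>The selected minor is itself a product through dimension \<open>r\<close>; for
  \<open>k > r\<close> a kernel vector of its wide right factor would make it singular.\<close>

lemma minor_le_inner_dim:
  fixes U V :: "'a::field mat"
  assumes U: "U \<in> carrier_mat m r" and V: "V \<in> carrier_mat r n"
    and p: "\<And>i. i < k \<Longrightarrow> p i < m" and q: "\<And>i. i < k \<Longrightarrow> q i < n"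
    and det: "det (mat k k (\<lambda>(i, j). (U * V) $$ (p i, q j))) \<noteq> 0"
  shows "k \<le> r"
proof (rule ccontr)
  assume "\<not> k \<le> r"
  define U' where "U' = mat k r (\<lambda>(i, j). U $$ (p i, j))"
  define V' where "V' = mat r k (\<lambda>(i, j). V $$ (i, q j))"
  have V': "V' \<in> carrier_mat r k" and U': "U' \<in> carrier_mat k r"
    by (simp_all add: V'_def U'_def)
  obtain x where x: "x \<in> carrier_vec k" "x \<noteq> 0\<^sub>v k" "V' *\<^sub>v x = 0\<^sub>v r"
    using wide_mat_kernel_nonzero[OF V'] \<open>\<not> k \<le> r\<close> by auto
  have "mat k k (\<lambda>(i, j). (U * V) $$ (p i, q j)) = U' * V'"
    using U V p q by (intro eq_matI) (auto simp: U'_def V'_def scalar_prod_def)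
  moreover have "(U' * V') *\<^sub>v x = 0\<^sub>v k"
    using U' V' x by (simp add: assoc_mult_mat_vec[OF U' V']) (auto intro!: eq_vecI)
  moreover have "U' * V' \<in> carrier_mat k k"
    using U' V' by simp
  ultimately show False
    using det x det_0_iff_vec_prod_zero_field[of "U' * V'" k] by auto
qed

text \<open>Translates nullity into inner dimensions of factorizations. With
  \<open>E = P * A\<close> the reduced echelon form and \<open>Q * P\<close> the identity,
  \<open>A = Q * E\<close>, and dropping the zero rows of \<open>E\<close> leaves a factorization
  through its \<open>r\<close> pivots.\<close>

lemma kernel_dim_factorization:
  fixes A :: "'a::field mat"
  assumes A: "A \<in> carrier_mat nr nc"
  obtains r U V where "kernel_dim A = nc - r" "r \<le> nc" "U \<in> carrier_mat nr r"
    "V \<in> carrier_mat r nc" "A = U * V"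
    "\<forall>s. \<forall>X\<in>carrier_mat nr s. \<forall>Z\<in>carrier_mat s nc. A = X * Z \<longrightarrow> r \<le> s"
proof -
  define E where "E = gauss_jordan_single A"
  note gj = gauss_jordan_single[OF A E_def[symmetric]]
  have E: "E \<in> carrier_mat nr nc" by (rule gj(2))
  obtain P Q where PQ: "E = P * A" "P \<in> carrier_mat nr nr" "Q \<in> carrier_mat nr nr"
    "Q * P = 1\<^sub>m nr"
    using gj(4) by blast
  obtain f where f: "pivot_fun E f nc"
    using gj(3) E by (auto simp: row_echelon_form_def)
  define pp where "pp = pivot_positions E"
  define r where "r = length pp"
  note pp = pivot_positions[OF E f, folded pp_def]
  note piv = pivot_funD[OF carrier_matD(1)[OF E] f]
  \<comment> \<open>\<open>p k\<close> is the row of pivot number \<open>k\<close> and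
    \<open>f (p k)\<close> its column; \<open>f i = nc\<close> marks a zero row.\<close>
  define p where "p k = fst (pp ! k)" for k
  have in_pp: "(p k, snd (pp ! k)) \<in> {(i, f i) | i. i < nr \<and> f i \<noteq> nc}" if "k < r" for k
    using that nth_mem[of k pp] unfolding pp(1) p_def r_def by simp
  have p: "p k < nr" "f (p k) < nc" if "k < r" for k
    using in_pp[OF that] piv(1)[of "p k"] by auto
  have p_inj: "inj_on p {..<r}"
    using pp(2) by (auto simp: inj_on_def p_def r_def distinct_conv_nth)
  have p_im: "p ` {..<r} = {i. i < nr \<and> f i \<noteq> nc}"
  proof -
    have "p ` {..<r} = fst ` set pp"
      by (force simp: p_def r_def set_conv_nth)
    then show ?thesis unfolding pp(1) by force
  qed
  have ident: "E $$ (p k, f (p l)) = (if k = l then 1 else 0)" if "k < r" "l < r" for k l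
    using piv(4)[of "p l"] piv(5)[of "p l" "p k"] p[OF that(1)] p[OF that(2)] p_inj that
    by (auto simp: inj_on_def)
  have zero: "E $$ (i, j) = 0" if "i < nr" "j < nc" "i \<notin> p ` {..<r}" for i j
    using that piv(2)[of i j] unfolding p_im by auto
  \<comment> \<open>Distinct pivots have distinct columns, so \<open>r \<le> nc\<close> and the
    difference \<open>nc - r\<close> is not truncated.\<close>
  have "inj_on (\<lambda>k. f (p k)) {..<r}"
  proof (rule inj_onI)
    fix k l assume "k \<in> {..<r}" "l \<in> {..<r}" "f (p k) = f (p l)"
    then show "k = l" using ident[of k k] ident[of k l] by (auto split: if_splits)
  qed
  then have "card {..<r} \<le> card {..<nc}"
    by (rule card_inj_on_le) (use p in auto)
  then have "r \<le> nc" by simp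
  have ker: "kernel_dim A = nc - r"
    unfolding kernel_dim_code r_def pp_def E_def using A by simp
  define U where "U = mat nr r (\<lambda>(i, k). Q $$ (i, p k))"
  define V where "V = mat r nc (\<lambda>(k, j). E $$ (p k, j))"
  have "A = Q * E"
    unfolding PQ(1) assoc_mult_mat[OF PQ(3,2) A, symmetric] PQ(4) using A by simp
  have "Q * E = U * V"
  proof (rule eq_matI)
    fix i j assume ij: "i < dim_row (U * V)" "j < dim_col (U * V)"
    then have ij': "i < nr" "j < nc" by (simp_all add: U_def V_def)
    have "(Q * E) $$ (i, j) = (\<Sum>l<nr. Q $$ (i, l) * E $$ (l, j))"
      using PQ(3) E ij' by (auto simp: scalar_prod_def atLeast0LessThan)
    also have "\<dots> = (\<Sum>l\<in>p ` {..<r}. Q $$ (i, l) * E $$ (l, j))"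
      using zero ij' p(1) by (intro sum.mono_neutral_right) auto
    also have "\<dots> = (\<Sum>k<r. Q $$ (i, p k) * E $$ (p k, j))"
      by (simp add: sum.reindex[OF p_inj])
    also have "\<dots> = (U * V) $$ (i, j)"
      using ij' by (auto simp: U_def V_def scalar_prod_def atLeast0LessThan)
    finally show "(Q * E) $$ (i, j) = (U * V) $$ (i, j)" .
  qed (use PQ E in \<open>auto simp: U_def V_def\<close>)
  \<comment> \<open>Minimality: \<open>A = X * Z\<close> gives \<open>E = P * X * Z\<close>, and the
    pivot rows and columns of \<open>E\<close> form an identity minor of size
    \<open>r\<close>.\<close>
  moreover have "r \<le> s" if X: "X \<in> carrier_mat nr s" and Z: "Z \<in> carrier_mat s nc"
    and "A = X * Z" for s X Z
  proof (rule minor_le_inner_dim)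
    show "P * X \<in> carrier_mat nr s" using PQ(2) X by simp
    show "Z \<in> carrier_mat s nc" by (rule Z)
    have "P * X * Z = E"
      using PQ that by simp
    then have "mat r r (\<lambda>(i, j). (P * X * Z) $$ (p i, f (p j))) = 1\<^sub>m r"
      by (intro eq_matI) (auto simp: ident)
    then show "det (mat r r (\<lambda>(i, j). (P * X * Z) $$ (p i, f (p j)))) \<noteq> 0" by simp
  qed (use p in auto)
  ultimately show ?thesis
    using that[of r U V] ker \<open>r \<le> nc\<close> \<open>A = Q * E\<close> by (auto simp: U_def V_def)
qed

text \<open>The rank is the size of a maximal independent set of columns. If it exceeded
  \<open>r\<close>, the corresponding columns of \<open>B\<close>, of length \<open>r\<close>, would
  satisfy a linear relation, which \<open>U\<close> carries over to the independent columns.\<close>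

lemma (in vec_space) rank_mult_le_inner_dim:
  assumes U: "U \<in> carrier_mat n r" and B: "B \<in> carrier_mat r nc"
  shows "rank (U * B) \<le> r"
proof (rule ccontr)
  let ?A = "U * B"
  have A: "?A \<in> carrier_mat n nc" using U B by simp
  have "\<exists>S. finite S \<and> maximal S (\<lambda>T. T \<subseteq> set (cols ?A) \<and> lin_indpt T) \<and> {} \<subseteq> S"
    by (rule maximal_exists_superset[of "set (cols ?A)"]) (auto simp: lin_dep_def)
  then obtain S where S: "finite S" "maximal S (\<lambda>T. T \<subseteq> set (cols ?A) \<and> lin_indpt T)"
    by blast
  then have sub: "S \<subseteq> set (cols ?A)" and ind: "lin_indpt S"
    by (simp_all add: maximal_def)
  obtain ss where ss: "set ss = S" "distinct ss"
    using finite_distinct_list[OF S(1)] by blast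
  assume "\<not> rank ?A \<le> r"
  then have r: "r < length ss"
    using rank_card_indpt[OF A S(2)] ss by (simp add: distinct_card[symmetric])
  have "\<forall>k<length ss. \<exists>j<nc. ss ! k = col ?A j"
  proof (intro allI impI)
    fix k assume "k < length ss"
    then have "ss ! k \<in> set (cols ?A)" using sub ss by auto
    then obtain j where "j < length (cols ?A)" "cols ?A ! j = ss ! k"
      by (auto simp: in_set_conv_nth simp del: cols_length)
    moreover from this have "j < nc" using A by (metis carrier_matD(2) cols_length)
    ultimately show "\<exists>j<nc. ss ! k = col ?A j"
      using A by (intro exI[of _ j]) simp
  qed
  then obtain j where j: "\<And>k. k < length ss \<Longrightarrow> j k < nc \<and> ss ! k = col ?A (j k)"
    by metis
  define W where "W = mat r (length ss) (\<lambda>(i, k). B $$ (i, j k))"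
  have W: "W \<in> carrier_mat r (length ss)" by (simp add: W_def)
  obtain x where x: "x \<in> carrier_vec (length ss)" "x \<noteq> 0\<^sub>v (length ss)" "W *\<^sub>v x = 0\<^sub>v r"
    using wide_mat_kernel_nonzero[OF W r] by auto
  have cols: "cols (U * W) = ss"
  proof (rule nth_equalityI)
    fix k assume "k < length (cols (U * W))"
    then have k: "k < length ss" using W by simp
    have "col (U * W) k = col ?A (j k)"
      using U B k j[OF k] by (intro eq_vecI) (auto simp: W_def scalar_prod_def)
    then show "cols (U * W) ! k = ss ! k" using j[OF k] W k by simp
  qed (use W in simp)
  have "U * W *\<^sub>v x = 0\<^sub>v n"
    using U x by (simp add: assoc_mult_mat_vec[OF U W]) (auto intro!: eq_vecI)
  then have "lin_dep (set (cols (U * W)))"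
    using lin_depI[OF mult_carrier_mat[OF U W] x(1,2)] cols ss by simp
  with ind cols ss show False by simp
qed

text \<open>\<open>U\<close> consists of a maximal independent set of columns of \<open>A\<close>,
  and \<open>B\<close> of the coefficients that express all columns through them.\<close>

lemma (in vec_space) rank_factorization:
  assumes A: "A \<in> carrier_mat n nc"
  obtains U B where "U \<in> carrier_mat n (rank A)" "B \<in> carrier_mat (rank A) nc" "A = U * B"
proof -
  have "\<exists>S. finite S \<and> maximal S (\<lambda>T. T \<subseteq> set (cols A) \<and> lin_indpt T) \<and> {} \<subseteq> S"
    by (rule maximal_exists_superset[of "set (cols A)"]) (auto simp: lin_dep_def)
  then obtain S where S: "finite S" "maximal S (\<lambda>T. T \<subseteq> set (cols A) \<and> lin_indpt T)"
    by blast
  then have sub: "S \<subseteq> set (cols A)" and ind: "lin_indpt S"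
    and max: "\<And>T. S \<subseteq> T \<Longrightarrow> T \<subseteq> set (cols A) \<Longrightarrow> lin_indpt T \<Longrightarrow> T = S"
    by (auto simp: maximal_def)
  obtain ss where ss: "set ss = S" "distinct ss"
    using finite_distinct_list[OF S(1)] by blast
  have len: "length ss = rank A"
    using rank_card_indpt[OF A S(2)] ss by (simp add: distinct_card[symmetric])
  have colsA: "set (cols A) \<subseteq> carrier_vec n" using A cols_dim by blast
  then have SC: "S \<subseteq> carrier_vec n" using sub by blast
  have "\<exists>x\<in>carrier_vec (rank A). col A j = mat_of_cols n ss *\<^sub>v x" if j: "j < nc" for j
  proof -
    have cj: "col A j \<in> set (cols A)" using A j by (simp add: cols_def)
    have "col A j \<in> span S"
    proof (cases "col A j \<in> S")
      case True
      then show ?thesis using SC span_mem by simp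
    next
      case False
      \<comment> \<open>By maximality another column creates a dependence, which puts that column
        into the span of \<open>S\<close>.\<close>
      then have "lin_dep (insert (col A j) S)"
        using max[of "insert (col A j) S"] cj sub by auto
      then show ?thesis
        using lin_dep_iff_in_span[of S "col A j"] SC ind cj colsA False by auto
    qed
    then have "\<exists>a. lincomb a S = col A j"
      using finite_in_span[OF S(1), of "col A j"] SC by auto
    then obtain a where "lincomb a S = col A j" by blast
    then have "col A j = lincomb_list (\<lambda>i. a (ss ! i)) ss"
      using lincomb_as_lincomb_list_distinct[of ss a] ss SC by simp
    also have "\<dots> = mat_of_cols n ss *\<^sub>v vec (length ss) (\<lambda>i. a (ss ! i))"
      by (rule lincomb_list_as_mat_mult) (use ss SC in auto)
    finally show ?thesis using len by auto
  qed
  then obtain x where x: "\<And>j. j < nc \<Longrightarrow> x j \<in> carrier_vec (rank A) \<and>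
      col A j = mat_of_cols n ss *\<^sub>v x j"
    by metis
  define B where "B = mat_of_cols (rank A) (map x [0..<nc])"
  have B: "B \<in> carrier_mat (rank A) nc"
    using mat_of_cols_carrier(1)[of "rank A" "map x [0..<nc]"] unfolding B_def by (metis length_map diff_zero length_upt)
  have U: "mat_of_cols n ss \<in> carrier_mat n (rank A)"
    using mat_of_cols_carrier(1)[of n ss] len by metis
  have "A = mat_of_cols n ss * B"
  proof (rule mat_col_eqI)
    fix j assume "j < dim_col (mat_of_cols n ss * B)"
    then have j: "j < nc" using B by simp
    have "col B j = x j"
      using j x[OF j] unfolding B_def by (subst col_mat_of_cols) auto
    then show "col A j = col (mat_of_cols n ss * B) j"
      using x[OF j] col_mult2[OF U B j] by simp
  qed (use A U B in auto)
  with U B that show ?thesis by blast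
qed

section \<open>Triangles\<close>

text \<open>A staircase is a triangle of \<open>Y\<close> given by the positions of its rows and columns, so that
  neither \<open>submatrix\<close> nor permutations have to be handled.\<close>

definition staircase :: "zn_entry mat \<Rightarrow> nat \<Rightarrow> (nat \<Rightarrow> nat) \<Rightarrow> (nat \<Rightarrow> nat) \<Rightarrow> bool" where
  "staircase Y k p q \<longleftrightarrow>
     (\<forall>i<k. p i < dim_row Y \<and> q i < dim_col Y \<and> Y $$ (p i, q i) = Star) \<and>
     (\<forall>i j. i < j \<longrightarrow> j < k \<longrightarrow> Y $$ (p i, q j) = Zero)"

text \<open>A repeated row or column would put \<open>Star\<close> and \<open>Zero\<close> at the
  same position.\<close>

lemma staircase_inj_on:
  assumes "staircase Y k p q"
  shows "inj_on p {..<k}" "inj_on q {..<k}"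
proof -
  have neq: "p i \<noteq> p j \<and> q i \<noteq> q j" if "i < j" "j < k" for i j
  proof -
    have "Y $$ (p i, q j) = Zero" "Y $$ (p i, q i) = Star" "Y $$ (p j, q j) = Star"
      using assms that by (auto simp: staircase_def)
    then show ?thesis by (metis zn_entry.distinct(1))
  qed
  show "inj_on p {..<k}"
    unfolding inj_on_def by (metis neq linorder_neqE_nat lessThan_iff)
  show "inj_on q {..<k}"
    unfolding inj_on_def by (metis neq linorder_neqE_nat lessThan_iff)
qed

text \<open>\<open>submatrix\<close> lists the chosen indices in increasing order through
  \<open>pick\<close>. Replacing \<open>f i\<close> by its rank within the range of \<open>f\<close>
  separates the index set from a permutation, as \<open>is_triangle\<close> requires.\<close>

lemma pick_factorization:
  fixes f :: "nat \<Rightarrow> nat"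
  assumes inj: "inj_on f {..<k}"
  obtains g where "g permutes {0..<k}" "\<And>i. i < k \<Longrightarrow> pick (f ` {..<k}) (g i) = f i"
proof -
  let ?I = "f ` {..<k}"
  define g where "g i = (if i < k then card {a \<in> ?I. a < f i} else i)" for i
  have cI: "card ?I = k" using card_image[OF inj] by simp
  have pick: "pick ?I (g i) = f i" if "i < k" for i
    using that pick_card_in_set[of "f i" ?I] by (simp add: g_def)
  have "g i < k" if "i < k" for i
  proof -
    have "{a \<in> ?I. a < f i} \<subset> ?I" using that by auto
    then have "card {a \<in> ?I. a < f i} < card ?I" by (intro psubset_card_mono) auto
    then show ?thesis using that cI by (simp add: g_def)
  qed
  then have "g ` {0..<k} \<subseteq> {0..<k}" by auto
  moreover have inj_g: "inj_on g {0..<k}"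
  proof (rule inj_onI)
    fix i j assume ij: "i \<in> {0..<k}" "j \<in> {0..<k}" "g i = g j"
    then have "f i = f j" using pick[of i] pick[of j] by simp
    then show "i = j" using inj ij by (auto dest: inj_onD)
  qed
  ultimately have "bij_betw g {0..<k} {0..<k}"
    by (simp add: bij_betw_def endo_inj_surj)
  then have "g permutes {0..<k}"
    by (rule bij_imp_permutes) (simp add: g_def)
  from this pick show ?thesis by (rule that)
qed

text \<open>The ranges of \<open>p\<close> and \<open>q\<close> serve as index sets, and their
  orders become the two permutations of \<open>is_triangle\<close>.\<close>

lemma staircase_le_tri:
  assumes st: "staircase Y k p q"
  shows "k \<le> tri Y"
proof -
  let ?I = "p ` {..<k}" and ?J = "q ` {..<k}"
  note inj = staircase_inj_on[OF st]
  obtain p' where p': "p' permutes {0..<k}" "\<And>i. i < k \<Longrightarrow> pick ?I (p' i) = p i"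
    using pick_factorization[OF inj(1)] by blast
  obtain q' where q': "q' permutes {0..<k}" "\<And>i. i < k \<Longrightarrow> pick ?J (q' i) = q i"
    using pick_factorization[OF inj(2)] by blast
  have I: "{i. i < dim_row Y \<and> i \<in> ?I} = ?I" and J: "{j. j < dim_col Y \<and> j \<in> ?J} = ?J"
    using st by (auto simp: staircase_def)
  have card: "card ?I = k" "card ?J = k"
    using inj by (simp_all add: card_image)
  have dim: "dim_row (submatrix Y ?I ?J) = k" "dim_col (submatrix Y ?I ?J) = k"
    unfolding dim_submatrix I J by (simp_all add: card)
  have entry: "submatrix Y ?I ?J $$ (p' i, q' j) = Y $$ (p i, q j)" if "i < k" "j < k" for i j
  proof -
    have "p' i < k" "q' j < k"
      using that permutes_in_image[OF p'(1), of i] permutes_in_image[OF q'(1), of j] by auto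
    then show ?thesis
      using that p'(2) q'(2) by (subst submatrix_index) (simp_all add: I J card)
  qed
  have star: "\<forall>i<k. submatrix Y ?I ?J $$ (p' i, q' i) = Star"
    using entry st unfolding staircase_def by metis
  have zero: "\<forall>i<k. \<forall>j<k. i < j \<longrightarrow> submatrix Y ?I ?J $$ (p' i, q' j) = Zero"
    using entry st unfolding staircase_def by metis
  have "is_triangle (submatrix Y ?I ?J)"
    unfolding is_triangle_def square_mat.simps dim using p'(1) q'(1) star zero by blast
  moreover have "?I \<subseteq> {0..<dim_row Y}" "?J \<subseteq> {0..<dim_col Y}"
    using I J by auto
  ultimately have "\<exists>I J. dim_row (submatrix Y ?I ?J) = dim_row (submatrix Y I J) \<and>
      I \<subseteq> {0..<dim_row Y} \<and> J \<subseteq> {0..<dim_col Y} \<and> is_triangle (submatrix Y I J)"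
    by (intro exI[of _ ?I] exI[of _ ?J]) simp
  then have "dim_row (submatrix Y ?I ?J) \<le> tri Y"
    unfolding tri_def by (intro Max_ge[OF finite_triangle_sizes]) (rule CollectI)
  then show ?thesis using dim(1) by simp
qed

text \<open>The maximum is attained, since the empty triangle keeps the set nonempty; composing the
  permutations with \<open>pick\<close> gives positions in \<open>Y\<close>.\<close>

lemma staircase_tri:
  obtains p q where "staircase Y (tri Y) p q"
proof -
  let ?S = "{dim_row (submatrix Y I J) | I J.
     I \<subseteq> {0..<dim_row Y} \<and> J \<subseteq> {0..<dim_col Y} \<and> is_triangle (submatrix Y I J)}"
  have "?S \<noteq> {}" using triangle_empty[of Y] by blast
  then have "tri Y \<in> ?S"
    unfolding tri_def by (rule Max_in[OF finite_triangle_sizes])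
  then obtain I J where dim: "tri Y = dim_row (submatrix Y I J)"
    and T: "is_triangle (submatrix Y I J)" by blast
  let ?k = "tri Y"
  have dims: "?k = card {i. i < dim_row Y \<and> i \<in> I}" "?k = card {j. j < dim_col Y \<and> j \<in> J}"
    using T unfolding is_triangle_def square_mat.simps dim dim_submatrix by simp_all
  obtain p q where p: "p permutes {0..<?k}" and q: "q permutes {0..<?k}"
    and star: "\<forall>i<?k. submatrix Y I J $$ (p i, q i) = Star"
    and zero: "\<forall>i<?k. \<forall>j<?k. i < j \<longrightarrow> submatrix Y I J $$ (p i, q j) = Zero"
    using T unfolding is_triangle_def dim by blast
  have lt: "p i < ?k" "q i < ?k" if "i < ?k" for i
    using that permutes_in_image[OF p, of i] permutes_in_image[OF q, of i] by auto
  have entry: "submatrix Y I J $$ (p i, q j) = Y $$ (pick I (p i), pick J (q j))"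
    if "i < ?k" "j < ?k" for i j
    using lt(1)[OF that(1)] lt(2)[OF that(2)] dims by (intro submatrix_index) metis+
  have "pick I (p i) < dim_row Y" "pick J (q i) < dim_col Y" if "i < ?k" for i
    using lt[OF that] dims by (metis pick_le)+
  then have "staircase Y ?k (\<lambda>i. pick I (p i)) (\<lambda>j. pick J (q j))"
    using star zero entry by (auto simp: staircase_def)
  then show ?thesis by (rule that)
qed

section \<open>Zero forcing\<close>

text \<open>The forces are recorded in order. A vertex that has forced is filled and from then on
  has only filled neighbours, so a vertex forced later is neither adjacent nor equal to it.\<close>

lemma forcing_chain:
  assumes "(force G)\<^sup>*\<^sup>* B C" "finite B"
  obtains k v u where "card C \<le> card B + k" "v ` {..<k} \<subseteq> C" "u ` {..<k} \<subseteq> C"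
    "\<And>i. i < k \<Longrightarrow> (v i, u i) \<in> parcs G"
    "\<And>i j. i < j \<Longrightarrow> j < k \<Longrightarrow> (v i, u j) \<notin> parcs G \<and> v i \<noteq> u j"
proof -
  \<comment> \<open>The induction carries the extra invariant that all neighbours of each
    \<open>v i\<close> lie in the current filled set.\<close>
  have "\<exists>k v u. card C \<le> card B + k \<and> v ` {..<k} \<subseteq> C \<and> u ` {..<k} \<subseteq> C \<and>
      (\<forall>i<k. (v i, u i) \<in> parcs G \<and> (\<forall>w. (v i, w) \<in> parcs G \<longrightarrow> w \<in> C)) \<and>
      (\<forall>i j. i < j \<longrightarrow> j < k \<longrightarrow> (v i, u j) \<notin> parcs G \<and> v i \<noteq> u j)"
    using assms(1)
  proof (induction rule: rtranclp_induct)
    case base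
    show ?case by (intro exI[of _ 0]) auto
  next
    case (step C D)
    from step.hyps(2) obtain w x where w: "w \<in> C"
      "{y. (w, y) \<in> parcs G \<and> y \<notin> C} = {x}" and D: "D = insert x C"
      by (cases rule: force.cases) auto
    from step.IH obtain k v u where IH: "card C \<le> card B + k \<and> v ` {..<k} \<subseteq> C \<and> u ` {..<k} \<subseteq> C \<and>
      (\<forall>i<k. (v i, u i) \<in> parcs G \<and> (\<forall>w. (v i, w) \<in> parcs G \<longrightarrow> w \<in> C)) \<and>
      (\<forall>i j. i < j \<longrightarrow> j < k \<longrightarrow> (v i, u j) \<notin> parcs G \<and> v i \<noteq> u j)"
      by (elim exE)
    have card: "card C \<le> card B + k" using IH by (rule conjunct1)
    have sub: "v ` {..<k} \<subseteq> C" "u ` {..<k} \<subseteq> C" using IH by blast+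
    have nb: "y \<in> C" if "i < k" "(v i, y) \<in> parcs G" for i y
      using IH that by blast
    have arc: "(v i, u i) \<in> parcs G" if "i < k" for i
      using IH that by blast
    have non: "(v i, u j) \<notin> parcs G \<and> v i \<noteq> u j" if "i < j" "j < k" for i j
      using IH that by blast
    have x: "x \<notin> C" "(w, x) \<in> parcs G" "\<And>y. (w, y) \<in> parcs G \<Longrightarrow> y \<in> D"
      using w(2) D by auto
    show ?case
    proof (rule exI[of _ "Suc k"], rule exI[of _ "v(k := w)"], rule exI[of _ "u(k := x)"],
        intro conjI allI impI)
      show "card D \<le> card B + Suc k"
        using card D by (cases "finite C") (auto simp: card_insert_if)
      show "(v(k := w)) ` {..<Suc k} \<subseteq> D" "(u(k := x)) ` {..<Suc k} \<subseteq> D"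
        using sub w(1) D by (auto simp: less_Suc_eq image_subset_iff)
      fix i assume i: "i < Suc k"
      show "((v(k := w)) i, (u(k := x)) i) \<in> parcs G"
        using i arc x(2) by (auto simp: less_Suc_eq)
      fix y assume "((v(k := w)) i, y) \<in> parcs G"
      then show "y \<in> D" using i nb x(3) D by (auto simp: less_Suc_eq split: if_splits)
    next
      fix i j assume ij: "i < j" "j < Suc k"
      have "v i \<noteq> x" "(v i, x) \<notin> parcs G" if "i < k" for i
        using that sub(1) nb x(1) by auto
      then show "((v(k := w)) i, (u(k := x)) j) \<notin> parcs G"
        "(v(k := w)) i \<noteq> (u(k := x)) j"
        using ij non by (auto simp: less_Suc_eq)
    qed
  qed
  then obtain k v u where *: "card C \<le> card B + k \<and> v ` {..<k} \<subseteq> C \<and> u ` {..<k} \<subseteq> C \<and>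
      (\<forall>i<k. (v i, u i) \<in> parcs G \<and> (\<forall>w. (v i, w) \<in> parcs G \<longrightarrow> w \<in> C)) \<and>
      (\<forall>i j. i < j \<longrightarrow> j < k \<longrightarrow> (v i, u j) \<notin> parcs G \<and> v i \<noteq> u j)"
    by (elim exE)
  show ?thesis
    by (rule that[of k v u]) (use * in blast)+
qed

text \<open>Once a vertex of the clique \<open>R\<close> has forced, all of \<open>R\<close> is filled except possibly the
  vertex it forced. Hence every later forced vertex lies in \<open>S\<close>, and every force except possibly
  the last one starts in \<open>R\<close>. Only the first head and the last tail may lie on the
  wrong side, and these two are replaced by neighbours, which exist by saturation.\<close>

lemma bipartite_chain:
  fixes E :: "('v \<times> 'v) set" and k :: nat
  assumes sym: "\<And>a b. (a, b) \<in> E \<Longrightarrow> (b, a) \<in> E"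
    and RR: "\<And>a b. a \<in> R \<Longrightarrow> b \<in> R \<Longrightarrow> a \<noteq> b \<Longrightarrow> (a, b) \<in> E"
    and SS: "\<And>a b. a \<in> S \<Longrightarrow> b \<in> S \<Longrightarrow> a \<noteq> b \<Longrightarrow> (a, b) \<in> E"
    and satR: "\<And>a. a \<in> R \<Longrightarrow> \<exists>b\<in>S. (a, b) \<in> E"
    and satS: "\<And>b. b \<in> S \<Longrightarrow> \<exists>a\<in>R. (b, a) \<in> E"
    and v: "v ` {..<k} \<subseteq> R \<union> S" and u: "u ` {..<k} \<subseteq> R \<union> S"
    and arc: "\<And>i. i < k \<Longrightarrow> (v i, u i) \<in> E"
    and non: "\<And>i j. i < j \<Longrightarrow> j < k \<Longrightarrow> (v i, u j) \<notin> E \<and> v i \<noteq> u j"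
    and v0: "v 0 \<in> R"
  shows "\<exists>p q. (\<forall>i<k. p i \<in> R \<and> q i \<in> S \<and> (p i, q i) \<in> E) \<and>
    (\<forall>i j. i < j \<longrightarrow> j < k \<longrightarrow> (p i, q j) \<notin> E)"
proof -
  have uS: "u j \<in> S" if "0 < j" "j < k" for j
  proof -
    have "u j \<in> R \<union> S" using u that by (auto simp: image_subset_iff)
    then show ?thesis using non[OF that] RR[OF v0, of "u j"] by blast
  qed
  have vR: "v i \<in> R" if "i < j" "j < k" for i j
  proof -
    have "v i \<in> R \<union> S" "u j \<in> S" using v uS[of j] that by (auto simp: image_subset_iff)
    then show ?thesis using non[OF that] SS[of "v i" "u j"] by blast
  qed
  \<comment> \<open>\<open>c\<close> stands in for \<open>u 0\<close> if the first force stays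
    inside \<open>R\<close>; the \<open>SOME\<close> neighbour stands in for a last
    \<open>v i\<close> outside \<open>R\<close>.\<close>
  obtain c where c: "c \<in> S" "(v 0, c) \<in> E" using satR[OF v0] by blast
  define q where "q i = (if u i \<in> S then u i else c)" for i
  define p where "p i = (if v i \<in> R then v i else SOME a. a \<in> R \<and> (q i, a) \<in> E)" for i
  have some: "(SOME a. a \<in> R \<and> (q i, a) \<in> E) \<in> R \<and> (q i, SOME a. a \<in> R \<and> (q i, a) \<in> E) \<in> E"
    if "q i \<in> S" for i
    using someI_ex[of "\<lambda>a. a \<in> R \<and> (q i, a) \<in> E"] satS[OF that] by blast
  have qS: "q i \<in> S" for i using c by (simp add: q_def)
  have "p i \<in> R \<and> (p i, q i) \<in> E" if "i < k" for i
  proof (cases "v i \<in> R")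
    case True
    have "(v i, q i) \<in> E"
      using arc[OF that] uS[of i] c(2) that by (cases "i = 0") (auto simp: q_def)
    with True show ?thesis by (simp add: p_def)
  next
    case False
    then show ?thesis using some[OF qS] sym by (simp add: p_def)
  qed
  \<comment> \<open>For \<open>i < j\<close> neither replacement occurs: \<open>q j = u j\<close>
    because \<open>0 < j\<close>, and \<open>p i = v i\<close> because \<open>i\<close> is not the
    last index.\<close>
  moreover have "(p i, q j) \<notin> E" if "i < j" "j < k" for i j
    using non[OF that] uS[of j] vR[OF that] that by (auto simp: p_def q_def)
  ultimately show ?thesis using qS by - (rule exI[of _ p], rule exI[of _ q], blast)
qed

section \<open>Zero forcing sets and staircases of the cobipartite graph\<close>

lemma cobipartite_graph_parcs_iff:
  "(u, v) \<in> parcs (cobipartite_graph Y) \<longleftrightarrow>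
     u < dim_row Y + dim_col Y \<and> v < dim_row Y + dim_col Y \<and> u \<noteq> v \<and>
     (if u < dim_row Y then v < dim_row Y \<or> Y $$ (u, v - dim_row Y) = Star
      else v < dim_row Y \<longrightarrow> Y $$ (v, u - dim_row Y) = Star)"
proof -
  let ?m = "dim_row Y" and ?n = "dim_col Y"
  have cross: "(a, b) \<in> {(i, ?m + j) | i j. i < ?m \<and> j < ?n \<and> Y $$ (i, j) = Star} \<longleftrightarrow>
      a < ?m \<and> ?m \<le> b \<and> b < ?m + ?n \<and> Y $$ (a, b - ?m) = Star" for a b
    by (auto intro!: exI[of _ "b - ?m"])
  have swap: "(a, b) \<in> {(?m + j, i) | i j. i < ?m \<and> j < ?n \<and> Y $$ (i, j) = Star} \<longleftrightarrow>
      (b, a) \<in> {(i, ?m + j) | i j. i < ?m \<and> j < ?n \<and> Y $$ (i, j) = Star}" for a b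
    by blast
  show ?thesis
    unfolding cobipartite_graph_def pair_pre_digraph.simps Un_iff swap cross
    by (auto simp: row_verts_def col_verts_def)
qed

text \<open>Filling all vertices takes a chain of at least
  \<open>dim_row Y + dim_col Y - card B\<close> forces, which \<open>bipartite_chain\<close>
  straightens into a staircase.\<close>

lemma zero_forcing_set_staircase:
  assumes zfs: "zero_forcing_set (cobipartite_graph Y) B"
    and sat: "saturated (cobipartite_graph Y) (row_verts Y) (col_verts Y)"
  obtains k p q where "staircase Y k p q" "dim_row Y + dim_col Y \<le> card B + k"
proof -
  let ?m = "dim_row Y" and ?G = "cobipartite_graph Y"
  let ?E = "parcs ?G" and ?R = "row_verts Y" and ?S = "col_verts Y"
  have P: "pverts ?G = ?R \<union> ?S" by (simp add: cobipartite_graph_def)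
  have "finite B" "(force ?G)\<^sup>*\<^sup>* B (pverts ?G)"
    using zfs finite_subset[of B] by (auto simp: zero_forcing_set_def pverts_cobipartite_graph)
  then obtain k v u where k: "card (pverts ?G) \<le> card B + k"
    and vu: "v ` {..<k} \<subseteq> ?R \<union> ?S" "u ` {..<k} \<subseteq> ?R \<union> ?S"
    "\<And>i. i < k \<Longrightarrow> (v i, u i) \<in> ?E"
    "\<And>i j. i < j \<Longrightarrow> j < k \<Longrightarrow> (v i, u j) \<notin> ?E \<and> v i \<noteq> u j"
    unfolding P using forcing_chain by metis
  have le: "?m + dim_col Y \<le> card B + k"
    using k by (simp add: pverts_cobipartite_graph)
  have sym: "(b, a) \<in> ?E" if "(a, b) \<in> ?E" for a b
    using that by (auto simp: cobipartite_graph_def)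
  have RR: "(a, b) \<in> ?E" if "a \<in> ?R" "b \<in> ?R" "a \<noteq> b" for a b
    using that by (auto simp: cobipartite_graph_def)
  have SS: "(a, b) \<in> ?E" if "a \<in> ?S" "b \<in> ?S" "a \<noteq> b" for a b
    using that by (auto simp: cobipartite_graph_def)
  have satR: "\<exists>b\<in>?S. (a, b) \<in> ?E" if "a \<in> ?R" for a
    using sat that by (auto simp: saturated_def)
  have satS: "\<exists>a\<in>?R. (b, a) \<in> ?E" if "b \<in> ?S" for b
    using sat that by (auto simp: saturated_def)
  have st: "staircase Y k p (\<lambda>i. q i - ?m)"
    if "\<And>i. i < k \<Longrightarrow> p i \<in> ?R \<and> q i \<in> ?S \<and> (p i, q i) \<in> ?E"
      "\<And>i j. i < j \<Longrightarrow> j < k \<Longrightarrow> (p i, q j) \<notin> ?E" for p q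
    unfolding staircase_def
  proof (intro conjI allI impI)
    fix i assume i: "i < k"
    show "p i < ?m" "q i - ?m < dim_col Y" "Y $$ (p i, q i - ?m) = Star"
      using that(1)[OF i] by (auto simp: row_verts_def col_verts_def cobipartite_graph_parcs_iff)
  next
    fix i j assume ij: "i < j" "j < k"
    have "p i \<in> ?R" "q j \<in> ?S" using that(1)[of i] that(1)[of j] ij by auto
    then have "Y $$ (p i, q j - ?m) \<noteq> Star"
      using that(2)[OF ij] by (auto simp: row_verts_def col_verts_def cobipartite_graph_parcs_iff)
    then show "Y $$ (p i, q j - ?m) = Zero" by (cases "Y $$ (p i, q j - ?m)") auto
  qed
  \<comment> \<open>The clique of the first forcing vertex decides which clique plays the role of
    \<open>R\<close>.\<close>
  consider "k = 0" | "k > 0" "v 0 \<in> ?R" | "k > 0" "v 0 \<in> ?S"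
    using vu(1) by (cases "k = 0") auto
  then show ?thesis
  proof cases
    case 1
    then have "staircase Y k (\<lambda>_. 0) (\<lambda>_. 0)" by (simp add: staircase_def)
    then show ?thesis using le by (rule that)
  next
    case 2
    have "\<exists>p q. (\<forall>i<k. p i \<in> ?R \<and> q i \<in> ?S \<and> (p i, q i) \<in> ?E) \<and>
        (\<forall>i j. i < j \<longrightarrow> j < k \<longrightarrow> (p i, q j) \<notin> ?E)"
      by (rule bipartite_chain[OF sym RR SS satR satS vu 2(2)])
    then obtain p q where pq: "\<forall>i<k. p i \<in> ?R \<and> q i \<in> ?S \<and> (p i, q i) \<in> ?E"
      "\<forall>i j. i < j \<longrightarrow> j < k \<longrightarrow> (p i, q j) \<notin> ?E"
      by (elim exE conjE)
    have "staircase Y k p (\<lambda>i. q i - ?m)" by (rule st) (use pq in simp_all)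
    then show ?thesis using le by (rule that)
  next
    case 3
    have swap: "v ` {..<k} \<subseteq> ?S \<union> ?R" "u ` {..<k} \<subseteq> ?S \<union> ?R" using vu(1,2) by auto
    have "\<exists>q p. (\<forall>i<k. q i \<in> ?S \<and> p i \<in> ?R \<and> (q i, p i) \<in> ?E) \<and>
        (\<forall>i j. i < j \<longrightarrow> j < k \<longrightarrow> (q i, p j) \<notin> ?E)"
      by (rule bipartite_chain[OF sym SS RR satS satR swap vu(3,4) 3(2)])
    then obtain q p where qp: "\<forall>i<k. q i \<in> ?S \<and> p i \<in> ?R \<and> (q i, p i) \<in> ?E"
      "\<forall>i j. i < j \<longrightarrow> j < k \<longrightarrow> (q i, p j) \<notin> ?E"
      by (elim exE conjE)
    \<comment> \<open>With the cliques exchanged the zeros lie below the diagonal; reversing the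
      order by \<open>k - Suc i\<close> moves them above it.\<close>
    have "staircase Y k (\<lambda>i. p (k - Suc i)) (\<lambda>i. q (k - Suc i) - ?m)"
    proof (rule st)
      fix i assume "i < k"
      then show "p (k - Suc i) \<in> ?R \<and> q (k - Suc i) \<in> ?S \<and> (p (k - Suc i), q (k - Suc i)) \<in> ?E"
        using qp(1)[rule_format, of "k - Suc i"] sym by auto
    next
      fix i j assume "i < j" "j < k"
      then have "(q (k - Suc j), p (k - Suc i)) \<notin> ?E" by (intro qp(2)[rule_format]) auto
      then show "(p (k - Suc i), q (k - Suc j)) \<notin> ?E" using sym by blast
    qed
    then show ?thesis using le by (rule that)
  qed
qed

text \<open>Start with all vertices except the \<open>k\<close> staircase columns. Row
  \<open>p j\<close> is adjacent to column \<open>q j\<close> and to no later \<open>q i\<close>, so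
  the rows \<open>p 0\<close>, \<open>p 1\<close>, ... force the missing columns in order.\<close>

lemma staircase_zero_forcing_set:
  assumes st: "staircase Y k p q"
  obtains B where "zero_forcing_set (cobipartite_graph Y) B"
    "card B = dim_row Y + dim_col Y - k"
proof -
  let ?m = "dim_row Y" and ?G = "cobipartite_graph Y"
  let ?f = "\<lambda>j. ?m + q j"
  define B where "B = pverts ?G - ?f ` {..<k}"
  have qk: "q j < dim_col Y" "p j < ?m" if "j < k" for j
    using st that by (auto simp: staircase_def)
  have inj: "inj_on ?f {..<k}"
    using staircase_inj_on(2)[OF st] by (auto simp: inj_on_def)
  have sub: "?f ` {..<k} \<subseteq> pverts ?G"
    using qk by (auto simp: pverts_cobipartite_graph)
  have card: "card B = ?m + dim_col Y - k"
    unfolding B_def using card_image[OF inj]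
    by (subst card_Diff_subset) (use sub in \<open>auto simp: pverts_cobipartite_graph\<close>)
  have "(force ?G)\<^sup>*\<^sup>* B (B \<union> ?f ` {..<j})" if "j \<le> k" for j
    using that
  proof (induction j)
    case 0
    then show ?case by simp
  next
    case (Suc j)
    then have j: "j < k" by simp
    let ?C = "B \<union> ?f ` {..<j}"
    have "p j \<in> ?C"
      using qk[OF j] by (auto simp: B_def pverts_cobipartite_graph)
    moreover have "{w. (p j, w) \<in> parcs ?G \<and> w \<notin> ?C} = {?f j}"
    proof (rule equalityI; rule subsetI)
      fix w assume "w \<in> {w. (p j, w) \<in> parcs ?G \<and> w \<notin> ?C}"
      then have w: "(p j, w) \<in> parcs ?G" "w \<notin> ?C" by auto
      then have "w \<in> pverts ?G"
        by (simp add: cobipartite_graph_parcs_iff pverts_cobipartite_graph)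
      \<comment> \<open>The unfilled vertices are the columns \<open>q i\<close> with
        \<open>j \<le> i\<close>; the zeros of the staircase exclude \<open>j < i\<close>.\<close>
      then obtain i where i: "w = ?f i" "i < k" "\<not> i < j" using w(2) by (auto simp: B_def)
      then have "Y $$ (p j, q i) = Star"
        using w(1) qk[OF j] by (auto simp: cobipartite_graph_parcs_iff)
      then have "\<not> j < i"
        using st i(2) by (auto simp: staircase_def)
      then show "w \<in> {?f j}" using i by auto
    next
      fix w assume "w \<in> {?f j}"
      moreover have "(p j, ?f j) \<in> parcs ?G"
        using st j by (auto simp: staircase_def cobipartite_graph_parcs_iff)
      moreover have "?f j \<notin> ?C"
      proof -
        have "?f j \<noteq> ?f i" if "i < j" for i
          using inj_onD[OF inj, of j i] that j by auto
        then have "?f j \<notin> ?f ` {..<j}" unfolding image_iff Bex_def lessThan_iff by blast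
        moreover have "?f j \<notin> B" using j by (simp add: B_def)
        ultimately show ?thesis by simp
      qed
      ultimately show "w \<in> {w. (p j, w) \<in> parcs ?G \<and> w \<notin> ?C}" by auto
    qed
    ultimately have "force ?G ?C (insert (?f j) ?C)" by (rule force.intros)
    moreover have "insert (?f j) ?C = B \<union> ?f ` {..<Suc j}"
      by (auto simp: lessThan_Suc)
    moreover have "(force ?G)\<^sup>*\<^sup>* B ?C" using Suc by simp
    ultimately show ?case by (simp only: rtranclp.rtrancl_into_rtrancl)
  qed
  from this[OF order_refl] have "(force ?G)\<^sup>*\<^sup>* B (B \<union> ?f ` {..<k})" .
  moreover have "B \<union> ?f ` {..<k} = pverts ?G" "B \<subseteq> pverts ?G"
    using sub by (auto simp: B_def)
  ultimately have "zero_forcing_set ?G B"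
    by (simp add: zero_forcing_set_def)
  then show ?thesis using card by (rule that)
qed

section \<open>Generic symmetric matrices\<close>

text \<open>On the moment curve \<open>(1, s, s^2, ...)\<close> the product
  \<open>w \<bullet> x\<close> is the value at \<open>s\<close> of the nonzero polynomial with
  coefficients \<open>w\<close>. Finitely many such polynomials have finitely many roots, and an
  infinite field has a further point.\<close>

lemma moment_vec_avoiding_hyperplanes:
  fixes W :: "'a::field vec set"
  assumes inf: "infinite (UNIV :: 'a set)" and fin: "finite W"
    and W: "W \<subseteq> carrier_vec r" "0\<^sub>v r \<notin> W"
  obtains x where "x \<in> carrier_vec r" "\<And>w. w \<in> W \<Longrightarrow> w \<bullet> x \<noteq> 0"
proof -
  define P where "P w = (\<Sum>k<r. monom (w $ k) k)" for w :: "'a vec"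
  have coeff: "coeff (P w) k = w $ k" if "k < r" for w k
    using that by (simp add: P_def coeff_sum)
  have "P w \<noteq> 0" if "w \<in> W" for w
  proof
    assume "P w = 0"
    then have "w = 0\<^sub>v r"
      using coeff[of _ w] W that by (intro eq_vecI) auto
    with W that show False by auto
  qed
  then have "finite (\<Union>w\<in>W. {s. poly (P w) s = 0})"
    using fin poly_roots_finite by blast
  then obtain s where s: "s \<notin> (\<Union>w\<in>W. {s. poly (P w) s = 0})"
    using ex_new_if_finite[OF inf] by blast
  define x where "x = vec r (\<lambda>k. s ^ k)"
  have "w \<bullet> x = poly (P w) s" if "w \<in> W" for w
    using that W
    by (auto simp: x_def P_def scalar_prod_def poly_sum poly_monom atLeast0LessThan)
  with s have "\<And>w. w \<in> W \<Longrightarrow> w \<bullet> x \<noteq> 0" by auto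
  then show ?thesis by (intro that[of x]) (auto simp: x_def)
qed

text \<open>Each pair excludes only the roots of the nonzero polynomial \<open>[:a, b:]\<close>,
  hence finitely many \<open>t\<close>.\<close>

lemma avoid_affine_roots:
  fixes L :: "('a::field \<times> 'a) set"
  assumes inf: "infinite (UNIV :: 'a set)" and fin: "finite L" and L: "(0, 0) \<notin> L"
  obtains t where "\<And>a b. (a, b) \<in> L \<Longrightarrow> a + t * b \<noteq> 0"
proof -
  have "finite {t. a + t * b = 0}" if "(a, b) \<in> L" for a b
  proof -
    have "[:a, b:] \<noteq> 0" using that L by auto
    then have "finite {t. poly [:a, b:] t = 0}" by (rule poly_roots_finite)
    then show ?thesis by simp
  qed
  then have "finite (\<Union>(a, b)\<in>L. {t. a + t * b = 0})"
    using fin by (intro finite_UN_I) auto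
  then obtain t where "t \<notin> (\<Union>(a, b)\<in>L. {t. a + t * b = 0})"
    using ex_new_if_finite[OF inf] by blast
  then show ?thesis using that[of t] by auto
qed

text \<open>With \<open>s = t / (1 + t * (x \<bullet> x))\<close> the matrices \<open>I + t x x\<^sup>T\<close> and
  \<open>I - s x x\<^sup>T\<close> are inverse to each other (Sherman-Morrison).\<close>

lemma generic_rank_one_perturbation:
  fixes X :: "'a::field vec set"
  assumes inf: "infinite (UNIV :: 'a set)" and fin: "finite X"
    and X: "X \<subseteq> carrier_vec r" "0\<^sub>v r \<notin> X"
  obtains x t s where "x \<in> carrier_vec r" "t - s - s * t * (x \<bullet> x) = 0"
    "\<forall>u\<in>X. \<forall>w\<in>X. u \<bullet> w + t * (u \<bullet> x) * (w \<bullet> x) \<noteq> 0"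
    "\<forall>u\<in>X. \<forall>w\<in>X. u \<bullet> w - s * (u \<bullet> x) * (w \<bullet> x) \<noteq> 0"
proof -
  obtain x where x: "x \<in> carrier_vec r" "\<And>w. w \<in> X \<Longrightarrow> w \<bullet> x \<noteq> 0"
    using moment_vec_avoiding_hyperplanes[OF inf fin X] by blast
  let ?c = "x \<bullet> x"
  \<comment> \<open>The pair \<open>(1, ?c)\<close> keeps the denominator of \<open>s\<close>
    nonzero. The first family gives the inequalities for \<open>t\<close>, the second those for
    \<open>s\<close> multiplied by \<open>1 + t * ?c\<close>.\<close>
  define L where "L = insert (1, ?c)
    ((\<lambda>(u, w). (u \<bullet> w, (u \<bullet> x) * (w \<bullet> x))) ` (X \<times> X) \<union>
     (\<lambda>(u, w). (u \<bullet> w, ?c * (u \<bullet> w) - (u \<bullet> x) * (w \<bullet> x))) ` (X \<times> X))"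
  have "finite L" using fin by (simp add: L_def)
  \<comment> \<open>In the second family, if \<open>u \<bullet> w = 0\<close> then the other entry
    is minus a product of two nonzero factors.\<close>
  moreover have "(0, 0) \<notin> L" using x(2) by (auto simp: L_def)
  ultimately obtain t where t: "\<And>a b. (a, b) \<in> L \<Longrightarrow> a + t * b \<noteq> 0"
    using avoid_affine_roots[OF inf] by blast
  define s where "s = t / (1 + t * ?c)"
  have c: "1 + t * ?c \<noteq> 0" using t[of 1 ?c] by (simp add: L_def)
  have st: "s * (1 + t * ?c) = t" using c by (simp add: s_def)
  have "u \<bullet> w + t * (u \<bullet> x) * (w \<bullet> x) \<noteq> 0" "u \<bullet> w - s * (u \<bullet> x) * (w \<bullet> x) \<noteq> 0"
    if uw: "u \<in> X" "w \<in> X" for u w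
  proof -
    have "(u \<bullet> w, (u \<bullet> x) * (w \<bullet> x)) \<in> L" using uw by (auto simp: L_def)
    from t[OF this] show "u \<bullet> w + t * (u \<bullet> x) * (w \<bullet> x) \<noteq> 0" by (simp add: mult.assoc)
    have "(u \<bullet> w, ?c * (u \<bullet> w) - (u \<bullet> x) * (w \<bullet> x)) \<in> L" using uw by (auto simp: L_def)
    from t[OF this] have "u \<bullet> w + t * (?c * (u \<bullet> w) - (u \<bullet> x) * (w \<bullet> x)) \<noteq> 0" .
    also have "u \<bullet> w + t * (?c * (u \<bullet> w) - (u \<bullet> x) * (w \<bullet> x)) =
        (1 + t * ?c) * (u \<bullet> w) - (s * (1 + t * ?c)) * ((u \<bullet> x) * (w \<bullet> x))"
      unfolding st by (simp add: algebra_simps)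
    also have "\<dots> = (1 + t * ?c) * (u \<bullet> w - s * (u \<bullet> x) * (w \<bullet> x))"
      by (simp add: algebra_simps)
    finally show "u \<bullet> w - s * (u \<bullet> x) * (w \<bullet> x) \<noteq> 0" by auto
  qed
  moreover have "t - s - s * t * ?c = 0" using st by (simp add: algebra_simps)
  ultimately show ?thesis using x(1) by (intro that[of x t s]) simp_all
qed

section \<open>Minimum rank and maximum nullity\<close>

lemma pattern_of_index:
  assumes "pattern_of A = Y"
  shows "dim_row A = dim_row Y" "dim_col A = dim_col Y"
    "\<And>i j. i < dim_row Y \<Longrightarrow> j < dim_col Y \<Longrightarrow> Y $$ (i, j) = Star \<longleftrightarrow> A $$ (i, j) \<noteq> 0"
    "\<And>i j. i < dim_row Y \<Longrightarrow> j < dim_col Y \<Longrightarrow> Y $$ (i, j) = Zero \<longleftrightarrow> A $$ (i, j) = 0"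
  using assms by (auto simp: pattern_of_def split: if_splits)

text \<open>With \<open>min_rank_factorization\<close> this makes the minimum rank the least inner
  dimension of a product with pattern \<open>Y\<close>, the form in which it is compared with
  nullities.\<close>

lemma min_rank_le_inner_dim:
  fixes U V :: "'a::field mat"
  assumes U: "U \<in> carrier_mat m r" and V: "V \<in> carrier_mat r n" and Y: "pattern_of (U * V) = Y"
  shows "min_rank TYPE('a) Y \<le> r"
proof -
  have m: "dim_row Y = m" using pattern_of_index(1)[OF Y] U by simp
  have "min_rank TYPE('a) Y \<le> vec_space.rank m (U * V)"
    unfolding min_rank_def by (intro Least_le exI[of _ "U * V"]) (simp add: Y m)
  also have "\<dots> \<le> r" by (rule vec_space.rank_mult_le_inner_dim[OF U V])
  finally show ?thesis .
qed

lemma min_rank_factorization: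
  obtains U V :: "'a::field mat" where
    "U \<in> carrier_mat (dim_row Y) (min_rank TYPE('a) Y)"
    "V \<in> carrier_mat (min_rank TYPE('a) Y) (dim_col Y)" "pattern_of (U * V) = Y"
proof -
  let ?P = "\<lambda>r. \<exists>A :: 'a mat. pattern_of A = Y \<and> vec_space.rank (dim_row Y) A = r"
  obtain A0 :: "'a mat" where "pattern_of A0 = Y" using pattern_exists by blast
  then have "?P (vec_space.rank (dim_row Y) A0)" by (intro exI[of _ A0]) simp
  then have "?P (min_rank TYPE('a) Y)" unfolding min_rank_def by (rule LeastI)
  then obtain A :: "'a mat" where A: "pattern_of A = Y"
    "vec_space.rank (dim_row Y) A = min_rank TYPE('a) Y" by (elim exE conjE)
  have "A \<in> carrier_mat (dim_row Y) (dim_col Y)"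
    using pattern_of_index(1,2)[OF A(1)] by (intro carrier_matI)
  from vec_space.rank_factorization[OF this]
  obtain U V where UV: "U \<in> carrier_mat (dim_row Y) (min_rank TYPE('a) Y)"
    "V \<in> carrier_mat (min_rank TYPE('a) Y) (dim_col Y)" "A = U * V"
    unfolding A(2) .
  from UV(1,2) A(1)[unfolded UV(3)] show ?thesis by (rule that)
qed

text \<open>In a matrix with pattern \<open>Y\<close> a largest triangle gives a lower triangular
  minor with nonzero diagonal, and the size of a nonzero minor is at most the inner
  dimension.\<close>

lemma tri_le_min_rank: "tri Y \<le> min_rank TYPE('a::field) Y"
proof -
  obtain U V :: "'a mat" where U: "U \<in> carrier_mat (dim_row Y) (min_rank TYPE('a) Y)"
    and V: "V \<in> carrier_mat (min_rank TYPE('a) Y) (dim_col Y)" and Y: "pattern_of (U * V) = Y"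
    by (rule min_rank_factorization)
  obtain p q where st: "staircase Y (tri Y) p q" by (rule staircase_tri)
  let ?k = "tri Y" and ?A = "U * V"
  let ?T = "mat ?k ?k (\<lambda>(i, j). ?A $$ (p i, q j))"
  have p: "p i < dim_row Y" and q: "q i < dim_col Y" and star: "Y $$ (p i, q i) = Star"
    if "i < ?k" for i
    using st that by (auto simp: staircase_def)
  have zero: "Y $$ (p i, q j) = Zero" if "i < j" "j < ?k" for i j
    using st that by (auto simp: staircase_def)
  have "det ?T = prod_list (diag_mat ?T)"
  proof (rule det_lower_triangular)
    fix i j assume ij: "i < j" "j < ?k"
    then show "?T $$ (i, j) = 0"
      using zero[OF ij] pattern_of_index(4)[OF Y, of "p i" "q j"] p[of i] q[of j] by simp
  qed simp
  moreover have "0 \<notin> set (diag_mat ?T)"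
  proof
    assume "0 \<in> set (diag_mat ?T)"
    then obtain i where i: "i < ?k" "?A $$ (p i, q i) = 0" by (auto simp: diag_mat_def)
    then show False
      using pattern_of_index(3)[OF Y p[OF i(1)] q[OF i(1)]] star[OF i(1)] by simp
  qed
  ultimately have "det ?T \<noteq> 0" by (simp add: prod_list_zero_iff)
  then show ?thesis
    using p q by (intro minor_le_inner_dim[OF U V, of ?k p q])
qed

text \<open>A largest staircase yields a zero forcing set of this size. Conversely, any zero forcing
  set yields a staircase of length at most \<open>tri Y\<close>; saturation enters here.\<close>

lemma zero_forcing_number_cobipartite_graph:
  assumes "saturated (cobipartite_graph Y) (row_verts Y) (col_verts Y)"
  shows "zero_forcing_number (cobipartite_graph Y) = dim_row Y + dim_col Y - tri Y"
  unfolding zero_forcing_number_def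
proof (rule Least_equality)
  obtain p q where "staircase Y (tri Y) p q" by (rule staircase_tri)
  then obtain B where "zero_forcing_set (cobipartite_graph Y) B"
    "card B = dim_row Y + dim_col Y - tri Y"
    by (rule staircase_zero_forcing_set)
  then show "\<exists>B. zero_forcing_set (cobipartite_graph Y) B \<and>
      card B = dim_row Y + dim_col Y - tri Y" by blast
next
  fix b assume "\<exists>B. zero_forcing_set (cobipartite_graph Y) B \<and> card B = b"
  then obtain B where B: "zero_forcing_set (cobipartite_graph Y) B" "card B = b"
    by (elim exE conjE)
  obtain k p q where "staircase Y k p q" "dim_row Y + dim_col Y \<le> card B + k"
    by (rule zero_forcing_set_staircase[OF B(1) assms])
  then show "dim_row Y + dim_col Y - tri Y \<le> b"
    using staircase_le_tri[of Y k p q] B(2) by simp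
qed

text \<open>The off-diagonal block of a matrix in \<open>sym_mats\<close> has pattern \<open>Y\<close> and inherits
  any factorization of the whole matrix.\<close>

lemma kernel_dim_sym_mats_le:
  fixes A :: "'a::field mat"
  assumes A: "A \<in> sym_mats (cobipartite_graph Y)"
  shows "kernel_dim A + min_rank TYPE('a) Y \<le> dim_row Y + dim_col Y"
proof -
  let ?m = "dim_row Y" and ?n = "dim_col Y" and ?G = "cobipartite_graph Y"
  have carrier: "A \<in> carrier_mat (?m + ?n) (?m + ?n)"
    using A by (simp add: sym_mats_def pverts_cobipartite_graph)
  have nz: "A $$ (i, j) \<noteq> 0 \<longleftrightarrow> (i, j) \<in> parcs ?G"
    if "i < ?m + ?n" "j < ?m + ?n" "i \<noteq> j" for i j
    using A that by (simp add: sym_mats_def pverts_cobipartite_graph)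
  obtain r U V where rUV: "kernel_dim A = ?m + ?n - r" "r \<le> ?m + ?n"
    "U \<in> carrier_mat (?m + ?n) r" "V \<in> carrier_mat r (?m + ?n)" "A = U * V"
    by (rule kernel_dim_factorization[OF carrier])
  \<comment> \<open>The first \<open>?m\<close> rows of \<open>U\<close> and the last
    \<open>?n\<close> columns of \<open>V\<close> factor the row-column block.\<close>
  define U' where "U' = mat ?m r (\<lambda>(i, k). U $$ (i, k))"
  define V' where "V' = mat r ?n (\<lambda>(k, j). V $$ (k, ?m + j))"
  have entry: "(U' * V') $$ (i, j) = A $$ (i, ?m + j)" if "i < ?m" "j < ?n" for i j
    using that rUV(3-5) by (auto simp: U'_def V'_def scalar_prod_def)
  have "pattern_of (U' * V') = Y"
  proof (rule eq_matI)
    fix i j assume ij: "i < ?m" "j < ?n"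
    then have "(U' * V') $$ (i, j) \<noteq> 0 \<longleftrightarrow> Y $$ (i, j) = Star"
      using nz[of i "?m + j"] entry[OF ij] by (simp add: cobipartite_graph_parcs_iff)
    moreover have "pattern_of (U' * V') $$ (i, j) = (if (U' * V') $$ (i, j) = 0 then Zero else Star)"
      using ij by (simp add: pattern_of_def U'_def V'_def)
    ultimately show "pattern_of (U' * V') $$ (i, j) = Y $$ (i, j)"
      by (cases "Y $$ (i, j)") auto
  qed (simp_all add: pattern_of_def U'_def V'_def)
  moreover have "U' \<in> carrier_mat ?m r" "V' \<in> carrier_mat r ?n"
    by (simp_all add: U'_def V'_def)
  ultimately have "min_rank TYPE('a) Y \<le> r" by (intro min_rank_le_inner_dim)
  with rUV(1,2) show ?thesis by simp
qed

text \<open>If \<open>U V\<close> has pattern \<open>Y\<close>, the rows of \<open>U\<close> and the columns of \<open>V\<close> are nonzero by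
  saturation. For an invertible symmetric \<open>S\<close> the symmetric matrix with blocks \<open>U S U\<^sup>T\<close>,
  \<open>U V\<close> and \<open>V\<^sup>T S\<inverse> V\<close> still factors through the inner dimension of \<open>U V\<close>, and a
  generic rank-one perturbation \<open>S\<close> of the identity makes all entries of the two diagonal
  blocks nonzero.\<close>

lemma kernel_dim_sym_mats_ge:
  assumes inf: "infinite (UNIV :: 'a::field set)"
    and sat: "saturated (cobipartite_graph Y) (row_verts Y) (col_verts Y)"
  obtains N :: "'a::field mat" where "N \<in> sym_mats (cobipartite_graph Y)"
    "dim_row Y + dim_col Y \<le> kernel_dim N + min_rank TYPE('a) Y"
proof -
  let ?m = "dim_row Y" and ?n = "dim_col Y" and ?G = "cobipartite_graph Y"
  let ?r = "min_rank TYPE('a) Y"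
  obtain U V :: "'a mat" where U: "U \<in> carrier_mat ?m ?r" and V: "V \<in> carrier_mat ?r ?n"
    and Y: "pattern_of (U * V) = Y"
    by (rule min_rank_factorization)
  have star: "Y $$ (i, j) = Star \<longleftrightarrow> row U i \<bullet> col V j \<noteq> 0" if "i < ?m" "j < ?n" for i j
    using pattern_of_index(3)[OF Y that] U V that by simp
  have U0: "row U i \<noteq> 0\<^sub>v ?r" if "i < ?m" for i
  proof
    assume 0: "row U i = 0\<^sub>v ?r"
    have "i \<in> row_verts Y" using that by (simp add: row_verts_def)
    with sat have "\<exists>w\<in>col_verts Y. (i, w) \<in> parcs ?G" by (simp add: saturated_def)
    then obtain w where "w \<in> col_verts Y" "(i, w) \<in> parcs ?G" by (elim bexE)
    then have "Y $$ (i, w - ?m) = Star" "w - ?m < ?n"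
      using that by (auto simp: col_verts_def cobipartite_graph_parcs_iff)
    then show False using star[of i "w - ?m"] 0 that V by simp
  qed
  have V0: "col V j \<noteq> 0\<^sub>v ?r" if "j < ?n" for j
  proof
    assume 0: "col V j = 0\<^sub>v ?r"
    have "?m + j \<in> col_verts Y" using that by (simp add: col_verts_def)
    with sat have "\<exists>w\<in>row_verts Y. (?m + j, w) \<in> parcs ?G" by (simp add: saturated_def)
    then obtain w where "w \<in> row_verts Y" "(?m + j, w) \<in> parcs ?G" by (elim bexE)
    then have "Y $$ (w, j) = Star" "w < ?m"
      by (auto simp: row_verts_def cobipartite_graph_parcs_iff)
    then show False using star[of w j] 0 that U by simp
  qed
  \<comment> \<open>One vector of length \<open>?r\<close> per vertex, so that the four blocks are
    treated uniformly.\<close>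
  define z where "z a = (if a < ?m then row U a else col V (a - ?m))" for a
  have z: "z a \<in> carrier_vec ?r" "z a \<noteq> 0\<^sub>v ?r" if "a < ?m + ?n" for a
  proof -
    have "dim_vec (row U a) = ?r" "dim_vec (col V (a - ?m)) = ?r" using U V by simp_all
    then show "z a \<in> carrier_vec ?r" by (intro carrier_vecI) (simp add: z_def)
    show "z a \<noteq> 0\<^sub>v ?r" using that U0[of a] V0[of "a - ?m"] by (simp add: z_def)
  qed
  have fin: "finite (z ` {..<?m + ?n})" and sub: "z ` {..<?m + ?n} \<subseteq> carrier_vec ?r"
    and zero: "0\<^sub>v ?r \<notin> z ` {..<?m + ?n}"
    using z(1) z(2)[symmetric] by (simp_all add: image_subset_iff image_iff)
  obtain x t s where x: "x \<in> carrier_vec ?r" and st: "t - s - s * t * (x \<bullet> x) = 0"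
    and plus: "\<forall>u\<in>z ` {..<?m + ?n}. \<forall>w\<in>z ` {..<?m + ?n}.
      u \<bullet> w + t * (u \<bullet> x) * (w \<bullet> x) \<noteq> 0"
    and minus: "\<forall>u\<in>z ` {..<?m + ?n}. \<forall>w\<in>z ` {..<?m + ?n}.
      u \<bullet> w - s * (u \<bullet> x) * (w \<bullet> x) \<noteq> 0"
    by (rule generic_rank_one_perturbation[OF inf fin sub zero])
  \<comment> \<open>With \<open>S = I + t x x^T\<close> and inverse \<open>I - s x x^T\<close>,
    \<open>rhs\<close> applies \<open>S\<close> to the vectors of row vertices and
    \<open>lhs\<close> applies the inverse to those of column vertices.\<close>
  define lhs where "lhs a = (if a < ?m then z a else z a - (s * (z a \<bullet> x)) \<cdot>\<^sub>v x)" for a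
  define rhs where "rhs a = (if a < ?m then z a + (t * (z a \<bullet> x)) \<cdot>\<^sub>v x else z a)" for a
  have carr: "lhs a \<in> carrier_vec ?r" "rhs a \<in> carrier_vec ?r" if "a < ?m + ?n" for a
    using z(1)[OF that] x by (auto simp: lhs_def rhs_def)
  define P where "P = mat (?m + ?n) ?r (\<lambda>(a, k). lhs a $ k)"
  define Q where "Q = mat ?r (?m + ?n) (\<lambda>(k, a). rhs a $ k)"
  have P: "P \<in> carrier_mat (?m + ?n) ?r" and Q: "Q \<in> carrier_mat ?r (?m + ?n)"
    by (simp_all add: P_def Q_def)
  define N where "N = P * Q"
  have N: "N \<in> carrier_mat (?m + ?n) (?m + ?n)" using P Q by (simp add: N_def)
  have comm: "u \<bullet> w = w \<bullet> u" if "u \<in> carrier_vec ?r" "w \<in> carrier_vec ?r" for u w :: "'a vec"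
    using that by (rule comm_scalar_prod)
  have prod: "N $$ (a, b) = lhs a \<bullet> rhs b" if "a < ?m + ?n" "b < ?m + ?n" for a b
    using that carr(1)[OF that(1)] carr(2)[OF that(2)]
    by (auto simp: N_def P_def Q_def scalar_prod_def)
  have entry: "N $$ (a, b) =
      (if a < ?m \<and> b < ?m then z a \<bullet> z b + t * (z a \<bullet> x) * (z b \<bullet> x)
       else if \<not> a < ?m \<and> \<not> b < ?m then z a \<bullet> z b - s * (z a \<bullet> x) * (z b \<bullet> x)
       else z a \<bullet> z b)" if ab: "a < ?m + ?n" "b < ?m + ?n" for a b
  proof -
    note za = z(1)[OF ab(1)] and zb = z(1)[OF ab(2)]
    have xz: "x \<bullet> z b = z b \<bullet> x" using x zb by (rule comm)
    \<comment> \<open>Only in the column-row block do both perturbations meet; by \<open>st\<close>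
      they cancel, which leaves the transpose of \<open>U * V\<close>.\<close>
    have "(z a - (s * (z a \<bullet> x)) \<cdot>\<^sub>v x) \<bullet> (z b + (t * (z b \<bullet> x)) \<cdot>\<^sub>v x) =
        z a \<bullet> z b + (t * (z b \<bullet> x)) * (z a \<bullet> x) - (s * (z a \<bullet> x)) * (z b \<bullet> x)
          - (s * (z a \<bullet> x)) * ((t * (z b \<bullet> x)) * (x \<bullet> x))"
      using za zb x xz
      by (simp add: minus_scalar_prod_distrib[of _ ?r] scalar_prod_add_distrib[of _ ?r] algebra_simps)
    also have "\<dots> = z a \<bullet> z b + (t - s - s * t * (x \<bullet> x)) * ((z a \<bullet> x) * (z b \<bullet> x))"
      by (simp add: algebra_simps)
    finally have cr: "(z a - (s * (z a \<bullet> x)) \<cdot>\<^sub>v x) \<bullet> (z b + (t * (z b \<bullet> x)) \<cdot>\<^sub>v x) = z a \<bullet> z b"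
      unfolding st by simp
    have rr: "z a \<bullet> (z b + (t * (z b \<bullet> x)) \<cdot>\<^sub>v x) = z a \<bullet> z b + t * (z a \<bullet> x) * (z b \<bullet> x)"
      using za zb x by (simp add: scalar_prod_add_distrib[of _ ?r] algebra_simps)
    have cc: "(z a - (s * (z a \<bullet> x)) \<cdot>\<^sub>v x) \<bullet> z b = z a \<bullet> z b - s * (z a \<bullet> x) * (z b \<bullet> x)"
      using za zb x xz by (simp add: minus_scalar_prod_distrib[of _ ?r] algebra_simps)
    show ?thesis
      unfolding prod[OF ab] lhs_def rhs_def using rr cc cr by simp
  qed
  have "transpose_mat N = N"
  proof (rule eq_matI)
    fix a b assume "a < dim_row N" "b < dim_col N"
    then have ab: "a < ?m + ?n" "b < ?m + ?n" using N by auto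
    have "N $$ (b, a) = N $$ (a, b)"
      unfolding entry[OF ab] entry[OF ab(2,1)] comm[OF z(1)[OF ab(1)] z(1)[OF ab(2)]]
      by (simp add: mult.commute mult.left_commute)
    then show "transpose_mat N $$ (a, b) = N $$ (a, b)" using N ab by simp
  qed (use N in auto)
  moreover have "N $$ (a, b) \<noteq> 0 \<longleftrightarrow> (a, b) \<in> parcs ?G"
    if ab: "a < ?m + ?n" "b < ?m + ?n" "a \<noteq> b" for a b
  proof -
    have mem: "z a \<in> z ` {..<?m + ?n}" "z b \<in> z ` {..<?m + ?n}" using ab by simp_all
    consider "a < ?m" "b < ?m" | "\<not> a < ?m" "\<not> b < ?m" | "a < ?m" "\<not> b < ?m" | "\<not> a < ?m" "b < ?m"
      by blast
    then show ?thesis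
    proof cases
      case 1
      then show ?thesis
        using plus[rule_format, OF mem] ab by (simp add: entry cobipartite_graph_parcs_iff)
    next
      case 2
      then show ?thesis
        using minus[rule_format, OF mem] ab by (simp add: entry cobipartite_graph_parcs_iff)
    next
      case 3
      then show ?thesis
        using star[of a "b - ?m"] ab by (simp add: entry cobipartite_graph_parcs_iff z_def)
    next
      case 4
      have "z a \<bullet> z b = z b \<bullet> z a" using z(1) ab by (intro comm)
      then show ?thesis
        using 4 star[of b "a - ?m"] ab by (simp add: entry cobipartite_graph_parcs_iff z_def)
    qed
  qed
  ultimately have "N \<in> sym_mats ?G"
    using N by (simp add: sym_mats_def pverts_cobipartite_graph)
  moreover obtain d where d: "kernel_dim N = ?m + ?n - d"
    "\<forall>k. \<forall>X\<in>carrier_mat (?m + ?n) k. \<forall>Z\<in>carrier_mat k (?m + ?n). N = X * Z \<longrightarrow> d \<le> k"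
    by (rule kernel_dim_factorization[OF N])
  \<comment> \<open>\<open>N = P * Q\<close> passes through dimension \<open>?r\<close>, and
    \<open>d\<close> is the least such dimension.\<close>
  have "d \<le> ?r" using d(2) P Q N_def by blast
  then have "?m + ?n \<le> kernel_dim N + ?r" using d(1) by simp
  ultimately show ?thesis by (rule that)
qed

theorem theorem4p11:
  fixes Y :: "zn_entry mat" and G :: "nat pair_pre_digraph" and m n :: nat
  assumes "Y \<in> carrier_mat m n"
    and "G = cobipartite_graph Y"
    and "saturated G (row_verts Y) (col_verts Y)"
  shows "(max_nullity TYPE('a::field) G = zero_forcing_number G
            \<longrightarrow> min_rank TYPE('a) Y = tri Y)
       \<and> (infinite (UNIV :: 'a set)
            \<longrightarrow> min_rank TYPE('a) Y = tri Y
            \<longrightarrow> max_nullity TYPE('a) G = zero_forcing_number G)"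
proof -
  let ?d = "dim_row Y + dim_col Y" and ?r = "min_rank TYPE('a) Y"
  note sat = assms(3)[unfolded assms(2)]
  have Z: "zero_forcing_number G = ?d - tri Y"
    unfolding assms(2) by (rule zero_forcing_number_cobipartite_graph[OF sat])
  let ?K = "kernel_dim ` (sym_mats G :: 'a mat set)"
  have "?K \<noteq> {}"
    using sym_mats_cobipartite_graph_nonempty[where 'a = 'a, of Y] by (simp add: assms(2))
  then have "max_nullity TYPE('a) G \<in> ?K"
    unfolding max_nullity_def by (rule Max_in[OF finite_nullities])
  then obtain A :: "'a mat" where "A \<in> sym_mats G" "max_nullity TYPE('a) G = kernel_dim A"
    by (rule imageE)
  then have upper: "max_nullity TYPE('a) G + ?r \<le> ?d"
    using kernel_dim_sym_mats_le[of A Y] by (simp add: assms(2))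
  have lower: "?d \<le> max_nullity TYPE('a) G + ?r" if inf: "infinite (UNIV :: 'a set)"
  proof -
    obtain N :: "'a mat" where N: "N \<in> sym_mats (cobipartite_graph Y)" "?d \<le> kernel_dim N + ?r"
      by (rule kernel_dim_sym_mats_ge[OF inf sat])
    have "kernel_dim N \<le> max_nullity TYPE('a) G"
      unfolding max_nullity_def using N(1) by (intro Max_ge[OF finite_nullities]) (simp add: assms(2))
    with N(2) show ?thesis by simp
  qed
  have tri: "tri Y \<le> ?r" by (rule tri_le_min_rank)
  show ?thesis
  proof (intro conjI impI)
    assume "max_nullity TYPE('a) G = zero_forcing_number G"
    \<comment> \<open>The nullity is at most \<open>?d - ?r\<close>, which is at most
      \<open>?d - tri Y\<close>, and the outer terms agree; \<open>?r \<le> ?d\<close> by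
      \<open>upper\<close>, so no difference is truncated.\<close>
    then show "?r = tri Y" using Z upper tri by linarith
  next
    assume "infinite (UNIV :: 'a set)" "?r = tri Y"
    then show "max_nullity TYPE('a) G = zero_forcing_number G" using Z upper lower by linarith
  qed
qed

end
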